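(* Let $F$ be an infinite field with $\operatorname{char}(F)=p>2$, and let $\star$ be the involution on the algebra $UT_2(F)$ of $2\times 2$ upper triangular matrices given by $$\begin{pmatrix} a&c\\0&b\end{pmatrix}^{\star}=\begin{pmatrix} b&c\\0&a\end{pmatrix}\qquad (a,b,c\in F).$$ The set of all $*$-central polynomials of $(UT_2(F),\star)$ is $$C(UT_2(F),\star)=Id(UT_2(F),\star)+\langle z_1z_2\rangle^{TS( * )}+\langle y_1^p\rangle^{TS( * )} .$$
   Context: All algebras are unitary and associative over $F$. Let $X=\{x_1,x_2,\ldots\}$ and $X^*=\{x_1^*,x_2^*,\ldots\}$ be disjoint infinite sets, and let $F\langle X\cup X^*\rangle$ be the free unitary associative $F$-algebra freely generated by $X\cup X^*$, with the $F$-linear involution $*$ determined by $x_i\leftrightarrow x_i^*$. Put $y_i=x_i+x_i^*$, $z_i=x_i-x_i^*$, $Y=\{y_1,y_2,\ldots\}$, $Z=\{z_1,z_2,\ldots\}$. Then $F\langle X\cup X^*\rangle=F\langle Y\cup Z\rangle$ is free on $Y\cup Z$, with $y_i^*=y_i$ and $z_i^*=-z_i$. For an algebra $A$ with involution $\circledast$, put $A^+=\{a\in A: a^\circledast=a\}$, $A^-=\{a\in A:a^\circledast=-a\}$. A polynomial $f(y_1,\ldots,y_n,z_1,\ldots,z_m)$ belongs to $Id(A,\circledast)$ (is a $*$-polynomial identity) if $f(a_1,\ldots,a_n,b_1,\ldots,b_m)=0$ for all $a_i\in A^+$, $b_j\in A^-$; it belongs to $C(A,\circledast)$ (is a $*$-central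 polynomial) if $f(a_1,\ldots,a_n,b_1,\ldots,b_m)\in Z(A)$, the center of $A$, for all $a_i\in A^+$, $b_j\in A^-$. A $*$-endomorphism of $F\langle Y\cup Z\rangle$ is a (unital) algebra endomorphism commuting with $*$. A $T( * )$-space is a vector subspace of $F\langle Y\cup Z\rangle$ closed under all $*$-endomorphisms; $\langle W\rangle^{TS( * )}$ is the smallest $T( * )$-space containing $W$. Equivalently it is spanned by all $f(g_1,\ldots,g_n,h_1,\ldots,h_m)$ with $f(y_1,\ldots,y_n,z_1,\ldots,z_m)\in W$, $g_i\in F\langle Y\cup Z\rangle^+$, $h_j\in F\langle Y\cup Z\rangle^-$. The sign $+$ between subspaces denotes the sum of vector subspaces. *)

theory Defs
  imports "HOL-Analysis.Analysis" "HOL-Library.Poly_Mapping" "HOL-Library.Set_Algebras"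
begin

section \<open>The free algebra on Y and Z\<close>

text \<open>In characteristic other than 2 the free algebra with involution on
  \<open>x\<^sub>i, x\<^sub>i\<^sup>*\<close> is free on \<open>y\<^sub>i = x\<^sub>i + x\<^sub>i\<^sup>*\<close> and \<open>z\<^sub>i = x\<^sub>i - x\<^sub>i\<^sup>*\<close>;
  these are the generators used here. Lemma \<open>free_on_x\<close> recovers \<open>x\<^sub>i, x\<^sub>i\<^sup>*\<close>.\<close>

datatype gen = Y nat | Z nat

text \<open>The free monoid, written additively because the convolution product of
  \<^type>\<open>poly_mapping\<close> is formed over an additive monoid of exponents.\<close>

datatype 'x word = Word (letters: "'x list")

instantiation word :: (type) monoid_add
begin
definition zero_word :: "'a word" where "0 = Word []"
definition plus_word :: "'a word \<Rightarrow> 'a word \<Rightarrow> 'a word"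
  where "u + v = Word (letters u @ letters v)"
instance by standard (simp_all add: zero_word_def plus_word_def)
end

lemma letters_zero [simp]: "letters 0 = []"
  by (simp add: zero_word_def)

lemma letters_plus [simp]: "letters (u + v) = letters u @ letters v"
  by (simp add: plus_word_def)

text \<open>A noncommutative polynomial is a finitely supported map from words to coefficients;
  its multiplication is that of \<^theory>\<open>HOL-Library.Poly_Mapping\<close>.\<close>

type_synonym 'f free_alg = "gen word \<Rightarrow>\<^sub>0 'f"

definition var :: "gen \<Rightarrow> 'f::field free_alg"
  where "var x = Poly_Mapping.single (Word [x]) 1"

definition fscale :: "'f::field \<Rightarrow> 'f free_alg \<Rightarrow> 'f free_alg"
  where "fscale c f = Poly_Mapping.map ((*) c) f"

text \<open>In an \<open>'f\<close>-algebra with scalar multiplication \<open>smul\<close>, \<open>evaluate smul g f\<close> is the value of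
  \<open>f\<close> under the substitution \<open>g\<close> of algebra elements for the generators.\<close>

definition evaluate ::
    "('f::field \<Rightarrow> 'a \<Rightarrow> 'a) \<Rightarrow> (gen \<Rightarrow> 'a::ring_1) \<Rightarrow> 'f free_alg \<Rightarrow> 'a"
  where "evaluate smul g f =
    (\<Sum>w\<in>Poly_Mapping.keys f. smul (Poly_Mapping.lookup f w) (prod_list (map g (letters w))))"

fun star_gen :: "gen \<Rightarrow> 'f::field free_alg" where
  "star_gen (Y i) = var (Y i)"
| "star_gen (Z i) = - var (Z i)"

text \<open>The linear extension of
  \<open>u\<^sub>1 \<dots> u\<^sub>k \<mapsto> u\<^sub>k\<^sup>* \<dots> u\<^sub>1\<^sup>*\<close>.\<close>

definition star :: "'f::field free_alg \<Rightarrow> 'f free_alg"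
  where "star f =
    (\<Sum>w\<in>Poly_Mapping.keys f.
       fscale (Poly_Mapping.lookup f w) (prod_list (map star_gen (rev (letters w)))))"


section \<open>Algebras with involution\<close>

text \<open>A unital associative algebra: the ring structure comes from the class \<open>ring_1\<close>, the vector
  space structure from \<open>scale\<close>.\<close>

locale unital_algebra = vector_space scale
  for scale :: "'f::field \<Rightarrow> 'a::ring_1 \<Rightarrow> 'a" +
  assumes scale_mult_left: "scale c a * b = scale c (a * b)"
    and scale_mult_right: "a * scale c b = scale c (a * b)"

locale involution_algebra = unital_algebra scale
  for scale :: "'f::field \<Rightarrow> 'a::ring_1 \<Rightarrow> 'a" +
  fixes invol :: "'a \<Rightarrow> 'a"
  assumes linear_invol: "Vector_Spaces.linear scale scale invol"
    and invol_mult: "invol (a * b) = invol b * invol a"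
    and invol_invol: "invol (invol a) = a"

definition unital_alg_hom ::
    "('f::field \<Rightarrow> 'a \<Rightarrow> 'a) \<Rightarrow> ('f \<Rightarrow> 'b \<Rightarrow> 'b) \<Rightarrow> ('a::ring_1 \<Rightarrow> 'b::ring_1) \<Rightarrow> bool"
  where "unital_alg_hom s t \<phi> \<longleftrightarrow>
    Vector_Spaces.linear s t \<phi> \<and> (\<forall>a b. \<phi> (a * b) = \<phi> a * \<phi> b) \<and> \<phi> 1 = 1"

definition sym_part :: "('a \<Rightarrow> 'a) \<Rightarrow> 'a set"
  where "sym_part invol = {a. invol a = a}"

definition skew_part :: "('a \<Rightarrow> 'a::ring_1) \<Rightarrow> 'a set"
  where "skew_part invol = {a. invol a = - a}"

definition center :: "'a::ring_1 set"
  where "center = {c. \<forall>a. c * a = a * c}"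

definition star_identities ::
    "('f::field \<Rightarrow> 'a \<Rightarrow> 'a) \<Rightarrow> ('a \<Rightarrow> 'a::ring_1) \<Rightarrow> 'f free_alg set"
  where "star_identities smul invol =
    {f. \<forall>a b. range a \<subseteq> sym_part invol \<longrightarrow> range b \<subseteq> skew_part invol \<longrightarrow>
          evaluate smul (case_gen a b) f = 0}"

definition star_central ::
    "('f::field \<Rightarrow> 'a \<Rightarrow> 'a) \<Rightarrow> ('a \<Rightarrow> 'a::ring_1) \<Rightarrow> 'f free_alg set"
  where "star_central smul invol =
    {f. \<forall>a b. range a \<subseteq> sym_part invol \<longrightarrow> range b \<subseteq> skew_part invol \<longrightarrow>
          evaluate smul (case_gen a b) f \<in> center}"

definition star_endomorphism :: "('f::field free_alg \<Rightarrow> 'f free_alg) \<Rightarrow> bool"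
  where "star_endomorphism \<phi> \<longleftrightarrow>
    unital_alg_hom fscale fscale \<phi> \<and> (\<forall>f. \<phi> (star f) = star (\<phi> f))"

definition TS_space :: "'f::field free_alg set \<Rightarrow> bool"
  where "TS_space V \<longleftrightarrow>
    module.subspace fscale V \<and> (\<forall>\<phi>. star_endomorphism \<phi> \<longrightarrow> \<phi> ` V \<subseteq> V)"

definition TS_span :: "'f::field free_alg set \<Rightarrow> 'f free_alg set"
  where "TS_span W = TS_space hull W"


section \<open>The free algebra is free, and \<open>star\<close> is an involution on it\<close>

lemma free_alg_induct [case_names zero add single]:
  assumes "P 0" and "\<And>f g. P f \<Longrightarrow> P g \<Longrightarrow> P (f + g)" and "\<And>w c. P (Poly_Mapping.single w c)"
  shows "P (f :: 'f::field free_alg)"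
proof -
  have "f = (\<Sum>w\<in>Poly_Mapping.keys f. Poly_Mapping.single w (Poly_Mapping.lookup f w))"
    by (rule poly_mapping_eqI)
      (simp add: lookup_sum lookup_single when_def in_keys_iff if_distrib sum.delta' cong: if_cong)
  moreover have "P (\<Sum>w\<in>A. Poly_Mapping.single w (Poly_Mapping.lookup f w))" if "finite A" for A
    using that by (induction A rule: finite_induct) (auto intro: assms)
  ultimately show ?thesis
    by (metis finite_keys)
qed

lemma fscale_conv_mult: "fscale c f = Poly_Mapping.single 0 c * f"
  by (simp add: fscale_def mult_map_scale_conv_mult)

lemma fscale_single: "fscale c (Poly_Mapping.single w d) = Poly_Mapping.single w (c * d)"
  by (simp add: fscale_conv_mult mult_single)

lemma mult_fscale: "f * fscale c g = fscale c (f * g)"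
proof -
  have "f * Poly_Mapping.single 0 c = Poly_Mapping.single 0 c * f"
    by (induction f rule: free_alg_induct) (simp_all add: algebra_simps mult_single)
  then show ?thesis
    by (simp add: fscale_conv_mult flip: mult.assoc)
qed

interpretation free_alg: unital_algebra "fscale :: 'f::field \<Rightarrow> 'f free_alg \<Rightarrow> 'f free_alg"
proof unfold_locales
  show "f * fscale c g = fscale c (f * g)" for c and f g :: "'f free_alg"
    by (rule mult_fscale)
qed (simp_all add: fscale_conv_mult algebra_simps single_add mult_single flip: mult.assoc)

context unital_algebra
begin

lemma sum_keys_superset:
  assumes "finite S" "Poly_Mapping.keys f \<subseteq> S"
  shows "(\<Sum>w\<in>Poly_Mapping.keys f. scale (Poly_Mapping.lookup f w) (h w)) =
    (\<Sum>w\<in>S. scale (Poly_Mapping.lookup f w) (h w))"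
  using assms by (intro sum.mono_neutral_left) (auto simp: in_keys_iff)

lemma sum_keys_add:
  "(\<Sum>w\<in>Poly_Mapping.keys (f + g). scale (Poly_Mapping.lookup (f + g) w) (h w)) =
    (\<Sum>w\<in>Poly_Mapping.keys f. scale (Poly_Mapping.lookup f w) (h w)) +
    (\<Sum>w\<in>Poly_Mapping.keys g. scale (Poly_Mapping.lookup g w) (h w))"
  (is "?l = ?r1 + ?r2")
proof -
  let ?S = "Poly_Mapping.keys f \<union> Poly_Mapping.keys g"
  have "?l = (\<Sum>w\<in>?S. scale (Poly_Mapping.lookup (f + g) w) (h w))"
    by (rule sum_keys_superset) (simp_all add: Poly_Mapping.keys_add)
  also have "\<dots> = (\<Sum>w\<in>?S. scale (Poly_Mapping.lookup f w) (h w)) +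
      (\<Sum>w\<in>?S. scale (Poly_Mapping.lookup g w) (h w))"
    by (simp add: lookup_add scale_left_distrib sum.distrib)
  also have "(\<Sum>w\<in>?S. scale (Poly_Mapping.lookup f w) (h w)) = ?r1"
    by (rule sum_keys_superset[symmetric]) auto
  also have "(\<Sum>w\<in>?S. scale (Poly_Mapping.lookup g w) (h w)) = ?r2"
    by (rule sum_keys_superset[symmetric]) auto
  finally show ?thesis .
qed

lemma sum_keys_single:
  "(\<Sum>w\<in>Poly_Mapping.keys (Poly_Mapping.single v c).
      scale (Poly_Mapping.lookup (Poly_Mapping.single v c) w) (h w)) = scale c (h v)"
  by (subst sum_keys_superset[where S = "{v}"]) (auto simp: lookup_single split: if_splits)

lemma evaluate_zero: "evaluate scale g 0 = 0"
  by (simp add: evaluate_def)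

lemma evaluate_add: "evaluate scale g (f + f') = evaluate scale g f + evaluate scale g f'"
  unfolding evaluate_def by (rule sum_keys_add)

lemma evaluate_single:
  "evaluate scale g (Poly_Mapping.single w c) = scale c (prod_list (map g (letters w)))"
  unfolding evaluate_def by (rule sum_keys_single)

lemma evaluate_var: "evaluate scale g (var x) = g x"
  by (simp add: var_def evaluate_single)

lemma evaluate_fscale: "evaluate scale g (fscale c f) = scale c (evaluate scale g f)"
  by (induction f rule: free_alg_induct)
    (simp_all add: evaluate_zero evaluate_add evaluate_single fscale_single
       free_alg.scale_right_distrib scale_right_distrib)

lemma evaluate_mult: "evaluate scale g (f * f') = evaluate scale g f * evaluate scale g f'"
proof (induction f rule: free_alg_induct)
  case (single w c)
  show ?case
    by (induction f' rule: free_alg_induct)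
      (simp_all add: evaluate_zero evaluate_add evaluate_single mult_single distrib_left
         scale_mult_left scale_mult_right)
qed (simp_all add: evaluate_zero evaluate_add distrib_right)

lemma evaluate_one: "evaluate scale g 1 = 1"
  using evaluate_single[of g 0 1] by simp

lemma evaluate_hom: "unital_alg_hom fscale scale (evaluate scale g)"
  unfolding unital_alg_hom_def
  by (auto simp: evaluate_mult evaluate_one evaluate_add evaluate_fscale
      intro!: linear_module_homI module_hom.intro module_hom_axioms.intro
        free_alg.module_axioms module_axioms)

lemma hom_eq_evaluate:
  assumes "unital_alg_hom fscale scale \<phi>"
  shows "\<phi> = evaluate scale (\<lambda>x. \<phi> (var x))"
proof
  from assms interpret Vector_Spaces.linear fscale scale \<phi>
    by (simp add: unital_alg_hom_def)
  have mult: "\<phi> (a * b) = \<phi> a * \<phi> b" and one: "\<phi> 1 = 1" for a b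
    using assms by (auto simp: unital_alg_hom_def)
  have word: "\<phi> (Poly_Mapping.single (Word xs) 1) = prod_list (map (\<lambda>x. \<phi> (var x)) xs)" for xs
  proof (induction xs)
    case Nil
    then show ?case using one by (simp add: flip: zero_word_def)
  next
    case (Cons x xs)
    have "Poly_Mapping.single (Word (x # xs)) (1 :: 'f) = var x * Poly_Mapping.single (Word xs) 1"
      by (simp add: var_def mult_single plus_word_def)
    then show ?case using Cons by (simp add: mult)
  qed
  fix f
  show "\<phi> f = evaluate scale (\<lambda>x. \<phi> (var x)) f"
  proof (induction f rule: free_alg_induct)
    case (single w c)
    have "Poly_Mapping.single w c = fscale c (Poly_Mapping.single (Word (letters w)) 1)"
      by (simp add: fscale_single)
    then have "\<phi> (Poly_Mapping.single w c) = scale c (\<phi> (Poly_Mapping.single (Word (letters w)) 1))"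
      by (metis scale)
    then show ?case by (simp only: word evaluate_single)
  qed (simp_all add: evaluate_zero evaluate_add add)
qed

end

lemma star_add: "star (f + g) = star f + star g"
  unfolding star_def by (rule free_alg.sum_keys_add)

lemma star_single:
  "star (Poly_Mapping.single w c) = fscale c (prod_list (map star_gen (rev (letters w))))"
  unfolding star_def by (rule free_alg.sum_keys_single)

lemma star_zero: "star 0 = 0"
  by (simp add: star_def)

lemma star_fscale: "star (fscale c f) = fscale c (star f)"
  by (induction f rule: free_alg_induct)
    (simp_all add: star_zero star_add star_single fscale_single free_alg.scale_right_distrib)

lemma star_mult: "star (f * g) = star g * star f"
proof (induction f rule: free_alg_induct)
  case (single w c)
  show ?case
    by (induction g rule: free_alg_induct)
      (simp_all add: star_zero star_add star_single mult_single distrib_left distrib_right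
         free_alg.scale_mult_left free_alg.scale_mult_right free_alg.scale_right_distrib
         mult.commute)
qed (simp_all add: star_zero star_add distrib_left distrib_right)

lemma star_var: "star (var x) = star_gen x"
  by (simp add: var_def star_single)

lemma star_uminus: "star (- f) = - star f"
  using star_add[of f "- f"] by (simp add: star_zero eq_neg_iff_add_eq_0 add.commute)

lemma star_star: "star (star f) = f"
proof (induction f rule: free_alg_induct)
  case (single w c)
  have gen: "star (star_gen x) = var x" for x :: gen
    by (cases x) (simp_all add: star_uminus star_var)
  have "star (prod_list (map star_gen (rev xs))) = Poly_Mapping.single (Word xs) (1::'a)" for xs
  proof (induction xs)
    case Nil
    have "star 1 = (1 :: 'a free_alg)"
      using star_single[of 0 1] by simp
    then show ?case by (simp flip: zero_word_def)
  next
    case (Cons x xs)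
    then show ?case
      by (simp add: star_mult gen) (simp add: var_def mult_single plus_word_def)
  qed
  then show ?case
    by (simp add: star_single star_fscale fscale_single)
qed (simp_all add: star_zero star_add)

interpretation free_alg: involution_algebra "fscale :: 'f::field \<Rightarrow> 'f free_alg \<Rightarrow> 'f free_alg" star
  by unfold_locales
    (auto simp: star_mult star_star star_add star_fscale)

text \<open>If 2 is invertible, the algebra is also free on the elements
  \<open>x\<^sub>i = (y\<^sub>i + z\<^sub>i) / 2\<close> together with their images under \<open>star\<close>.\<close>

lemma free_on_x:
  fixes smul :: "'f::field \<Rightarrow> 'a::ring_1 \<Rightarrow> 'a"
  assumes "unital_algebra smul" and "(2 :: 'f) \<noteq> 0"
  defines "x \<equiv> \<lambda>i. fscale (1 / 2 :: 'f) (var (Y i) + var (Z i))"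
  shows "var (Y i) = x i + star (x i)" and "var (Z i) = x i - star (x i)"
    and "\<exists>!\<phi>. unital_alg_hom fscale smul \<phi> \<and> (\<forall>i. \<phi> (x i) = u i \<and> \<phi> (star (x i)) = v i)"
proof -
  interpret unital_algebra smul by fact
  have half: "fscale (1 / 2 :: 'f) f + fscale (1 / 2) f = f" for f
    using assms(2) by (simp flip: free_alg.scale_left_distrib add: field_simps)
  have half': "smul (1 / 2) a + smul (1 / 2) a = a" for a
    using assms(2) by (simp flip: scale_left_distrib add: field_simps)
  have sx: "star (x i) = fscale (1 / 2) (var (Y i) - var (Z i))" for i
    by (simp add: x_def star_fscale star_add star_var)
  show Yx: "var (Y i) = x i + star (x i)" for i
    unfolding sx unfolding x_def
    by (simp add: free_alg.scale_right_distrib free_alg.scale_right_diff_distrib half)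
  show Zx: "var (Z i) = x i - star (x i)" for i
    unfolding sx unfolding x_def
    by (simp add: free_alg.scale_right_distrib free_alg.scale_right_diff_distrib half)
  let ?g = "case_gen (\<lambda>i. u i + v i) (\<lambda>i. u i - v i)"
  let ?\<phi> = "evaluate smul ?g"
  have "unital_alg_hom fscale smul ?\<phi>" by (rule evaluate_hom)
  moreover have "?\<phi> (x i) = u i" for i
    by (simp add: x_def evaluate_fscale evaluate_add evaluate_var scale_right_distrib
        scale_right_diff_distrib half')
  moreover have "?\<phi> (star (x i)) = v i" for i
  proof -
    have "?\<phi> (var (Y i)) = ?\<phi> (x i) + ?\<phi> (star (x i))"
      by (simp add: Yx evaluate_add)
    then show ?thesis using \<open>?\<phi> (x i) = u i\<close> by (simp add: evaluate_var)
  qed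
  moreover have "\<phi> = ?\<phi>"
    if hom: "unital_alg_hom fscale smul \<phi>"
      and vals: "\<forall>i. \<phi> (x i) = u i \<and> \<phi> (star (x i)) = v i" for \<phi>
  proof -
    from hom interpret Vector_Spaces.linear fscale smul \<phi>
      by (simp add: unital_alg_hom_def)
    have "(\<lambda>x. \<phi> (var x)) = ?g"
    proof
      fix w show "\<phi> (var w) = ?g w"
        by (cases w) (simp_all add: Yx Zx add diff vals)
    qed
    then show ?thesis using hom_eq_evaluate[OF hom] by simp
  qed
  ultimately show
    "\<exists>!\<phi>. unital_alg_hom fscale smul \<phi> \<and> (\<forall>i. \<phi> (x i) = u i \<and> \<phi> (star (x i)) = v i)"
    by blast
qed

section \<open>Upper triangular matrices\<close>

typedef (overloaded) ('f::field) UT2 = "{A :: 'f^2^2. A $ 2 $ 1 = 0}"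
  morphisms mat_of UT2_of
  by (rule exI[of _ 0]) simp

setup_lifting type_definition_UT2

instantiation UT2 :: (field) ring_1
begin
lift_definition zero_UT2 :: "'a UT2" is 0 by simp
lift_definition one_UT2 :: "'a UT2" is "mat 1" by (simp add: mat_def)
lift_definition plus_UT2 :: "'a UT2 \<Rightarrow> 'a UT2 \<Rightarrow> 'a UT2" is "(+)" by simp
lift_definition minus_UT2 :: "'a UT2 \<Rightarrow> 'a UT2 \<Rightarrow> 'a UT2" is "(-)" by simp
lift_definition uminus_UT2 :: "'a UT2 \<Rightarrow> 'a UT2" is uminus by simp
lift_definition times_UT2 :: "'a UT2 \<Rightarrow> 'a UT2 \<Rightarrow> 'a UT2" is "(**)"
  by (simp add: matrix_matrix_mult_def sum_2)
instance
proof
  fix a b c :: "'a UT2"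
  show "0 \<noteq> (1 :: 'a UT2)"
    by transfer (simp add: vec_eq_iff forall_2 mat_def)
  show "a * b * c = a * (b * c)"
    by transfer (simp add: matrix_mul_assoc)
  show "(a + b) * c = a * c + b * c" "a * (b + c) = a * b + a * c"
    by (transfer; simp add: matrix_matrix_mult_def vec_eq_iff sum_2 algebra_simps)+
qed (transfer; simp)+
end

lift_definition UT2_scale :: "'f::field \<Rightarrow> 'f UT2 \<Rightarrow> 'f UT2"
  is "\<lambda>c A. \<chi> i j. c * A $ i $ j" by simp

lift_definition UT2_star :: "'f::field UT2 \<Rightarrow> 'f UT2"
  is "\<lambda>A. vector [vector [A $ 2 $ 2, A $ 1 $ 2], vector [0, A $ 1 $ 1]]" by simp

interpretation UT2: involution_algebra "UT2_scale :: 'f::field \<Rightarrow> 'f UT2 \<Rightarrow> 'f UT2" UT2_star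
proof -
  interpret unital_algebra "UT2_scale :: 'f \<Rightarrow> 'f UT2 \<Rightarrow> 'f UT2"
    by unfold_locales
      (transfer; simp add: vec_eq_iff forall_2 matrix_matrix_mult_def sum_2 algebra_simps)+
  have "UT2_star (a + b) = UT2_star a + UT2_star b" for a b :: "'f UT2"
    by transfer (simp add: vec_eq_iff forall_2)
  moreover have "UT2_star (UT2_scale c a) = UT2_scale c (UT2_star a)" for c and a :: "'f UT2"
    by transfer (simp add: vec_eq_iff forall_2)
  ultimately have "Vector_Spaces.linear UT2_scale UT2_scale (UT2_star :: 'f UT2 \<Rightarrow> 'f UT2)"
    by unfold_locales
  moreover have "UT2_star (a * b) = UT2_star b * UT2_star a" for a b :: "'f UT2"
    by transfer (simp add: vec_eq_iff forall_2 matrix_matrix_mult_def sum_2 algebra_simps)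
  moreover have "UT2_star (UT2_star a) = a" for a :: "'f UT2"
    by transfer (simp add: vec_eq_iff forall_2)
  ultimately show "involution_algebra (UT2_scale :: 'f \<Rightarrow> _) UT2_star"
    by (intro involution_algebra.intro involution_algebra_axioms.intro unital_algebra_axioms)
qed

end

theory Submission
  imports Defs "HOL-Computational_Algebra.Polynomial"
begin

text \<open>Under an admissible substitution the \<open>y\<^sub>i\<close> become \<open>a\<^sub>i + c\<^sub>i e\<^sub>1\<^sub>2\<close> and the \<open>z\<^sub>j\<close> become
  \<open>b\<^sub>j (e\<^sub>1\<^sub>1 - e\<^sub>2\<^sub>2)\<close>. For a word \<open>w\<close> with an even positive number of \<open>z\<close>, remove one letter \<open>z\<^sub>j\<close>
  to get \<open>w'\<close>: then \<open>z\<^sub>j (w' - w'\<^sup>*) / 2\<close> takes the scalar value \<open>w(a, b)\<close> and is a consequence of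
  \<open>z\<^sub>1 z\<^sub>2\<close>. For a word in the \<open>y\<close> alone whose degrees are all divisible by \<open>p\<close>, take \<open>w'\<close> with
  all degrees divided by \<open>p\<close>: then \<open>((w' + w'\<^sup>*) / 2)\<^sup>p\<close> takes the scalar value \<open>w(a)\<close>.
  Subtracting these from a central polynomial leaves words with an odd number of \<open>z\<close>, whose
  contributions cancel because the diagonal entries of a central value agree, and words in the
  \<open>y\<close> with some degree not divisible by \<open>p\<close>; these cancel because the upper right entry is a derivation
  of the commutative polynomial in the \<open>a\<^sub>i\<close>, all of whose partial derivatives hence vanish.\<close>

section \<open>Substitutions compatible with the involution\<close>

text \<open>For \<open>invol = star\<close> these are exactly the restrictions of
  \<open>*\<close>-endomorphisms to the generators.\<close>

definition star_subst :: "('a \<Rightarrow> 'a::ring_1) \<Rightarrow> (gen \<Rightarrow> 'a) \<Rightarrow> bool"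
  where "star_subst invol g \<longleftrightarrow>
    (\<forall>i. g (Y i) \<in> sym_part invol) \<and> (\<forall>j. g (Z j) \<in> skew_part invol)"

lemma case_gen_expand: "case_gen (\<lambda>i. g (Y i)) (\<lambda>j. g (Z j)) = g"
  by (rule ext) (simp split: gen.split)

lemma star_subst_range:
  "(\<forall>a b. range a \<subseteq> sym_part invol \<longrightarrow> range b \<subseteq> skew_part invol \<longrightarrow> P (case_gen a b)) \<longleftrightarrow>
    (\<forall>g. star_subst invol g \<longrightarrow> P g)"
proof (intro iffI allI impI)
  fix g
  assume P: "\<forall>a b. range a \<subseteq> sym_part invol \<longrightarrow> range b \<subseteq> skew_part invol \<longrightarrow> P (case_gen a b)"
    and "star_subst invol g"
  then have "range (\<lambda>i. g (Y i)) \<subseteq> sym_part invol" "range (\<lambda>j. g (Z j)) \<subseteq> skew_part invol"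
    by (auto simp: star_subst_def)
  then have "P (case_gen (\<lambda>i. g (Y i)) (\<lambda>j. g (Z j)))"
    using P by blast
  then show "P g" by (simp only: case_gen_expand)
next
  fix a b :: "nat \<Rightarrow> 'a"
  assume "\<forall>g. star_subst invol g \<longrightarrow> P g"
    and "range a \<subseteq> sym_part invol" "range b \<subseteq> skew_part invol"
  moreover from this have "star_subst invol (case_gen a b)"
    by (auto simp: star_subst_def)
  ultimately show "P (case_gen a b)" by blast
qed

lemma star_identities_iff:
  "f \<in> star_identities smul invol \<longleftrightarrow> (\<forall>g. star_subst invol g \<longrightarrow> evaluate smul g f = 0)"
  unfolding star_identities_def mem_Collect_eq by (rule star_subst_range)

lemma star_central_iff:
  "f \<in> star_central smul invol \<longleftrightarrow> (\<forall>g. star_subst invol g \<longrightarrow> evaluate smul g f \<in> center)"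
  unfolding star_central_def mem_Collect_eq by (rule star_subst_range)

context involution_algebra
begin

sublocale inv: Vector_Spaces.linear scale scale invol
  by (rule linear_invol)

lemma invol_one: "invol 1 = 1"
  by (metis invol_invol invol_mult mult_1_right)

text \<open>Both sides are linear in \<open>f\<close> and reverse products, so only the generators
  have to be compared.\<close>

lemma evaluate_star:
  assumes "star_subst invol g"
  shows "evaluate scale g (star f) = invol (evaluate scale g f)"
proof -
  have gen: "evaluate scale g (star_gen x) = invol (g x)" for x
  proof (cases x)
    case (Y i)
    then show ?thesis
      using assms by (simp add: evaluate_var star_subst_def sym_part_def)
  next
    case (Z j)
    interpret e: Vector_Spaces.linear fscale scale "evaluate scale g"
      using evaluate_hom unfolding unital_alg_hom_def by blast
    show ?thesis
      using Z assms by (simp add: e.neg evaluate_var star_subst_def skew_part_def)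
  qed
  have "evaluate scale g (prod_list (map star_gen (rev xs))) = invol (prod_list (map g xs))" for xs
    by (induction xs) (simp_all add: evaluate_one invol_one evaluate_mult invol_mult gen)
  then show ?thesis
    by (induction f rule: free_alg_induct)
      (simp_all add: star_zero evaluate_zero star_add evaluate_add inv.add star_single
        evaluate_fscale evaluate_single inv.scale)
qed

text \<open>The reason why centrality survives \<open>\<phi>\<close>: since both maps respect the
  involutions, \<open>\<phi>\<close> can be absorbed into the substitution.\<close>

lemma evaluate_comp_star_endomorphism:
  assumes "star_endomorphism \<phi>" "star_subst invol g"
  shows "star_subst invol (\<lambda>x. evaluate scale g (\<phi> (var x)))"
    and "evaluate scale g (\<phi> f) = evaluate scale (\<lambda>x. evaluate scale g (\<phi> (var x))) f"
proof -
  have hom: "unital_alg_hom fscale fscale \<phi>" and st: "\<phi> (star f) = star (\<phi> f)" for f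
    using assms(1) by (auto simp: star_endomorphism_def)
  interpret \<phi>: Vector_Spaces.linear fscale fscale \<phi>
    using hom by (simp add: unital_alg_hom_def)
  interpret e: Vector_Spaces.linear fscale scale "evaluate scale g"
    using evaluate_hom unfolding unital_alg_hom_def by blast
  have "invol (evaluate scale g (\<phi> (var x))) = evaluate scale g (\<phi> (star_gen x))" for x
    by (simp add: evaluate_star[OF assms(2), symmetric] flip: st star_var)
  then show "star_subst invol (\<lambda>x. evaluate scale g (\<phi> (var x)))"
    by (simp add: star_subst_def sym_part_def skew_part_def \<phi>.neg e.neg)
  have "unital_alg_hom fscale scale (\<lambda>f. evaluate scale g (\<phi> f))"
    using hom by (auto simp: unital_alg_hom_def evaluate_mult evaluate_one evaluate_add
      evaluate_fscale \<phi>.add \<phi>.scale intro!: linear_module_homI module_hom.intro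
      module_hom_axioms.intro free_alg.module_axioms module_axioms)
  from hom_eq_evaluate[OF this]
  show "evaluate scale g (\<phi> f) = evaluate scale (\<lambda>x. evaluate scale g (\<phi> (var x))) f"
    by (rule fun_cong)
qed

end

section \<open>T-spaces of the free algebra and their generation\<close>

lemma star_endomorphism_evaluate:
  assumes "star_subst star g"
  shows "star_endomorphism (evaluate fscale g)"
  using assms
  by (simp add: star_endomorphism_def free_alg.evaluate_hom free_alg.evaluate_star)

lemma TS_space_TS_span: "TS_space (TS_span S)"
  unfolding TS_span_def
proof (rule hull_in)
  fix T :: "'a free_alg set set"
  assume "\<forall>V\<in>T. TS_space V"
  then show "TS_space (\<Inter>T)"
    unfolding TS_space_def image_subset_iff by (blast intro: free_alg.subspace_Inter)
qed

lemma subspace_TS_span: "free_alg.subspace (TS_span S)"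
  using TS_space_TS_span by (auto simp: TS_space_def)

lemma TS_span_evaluate:
  assumes "f \<in> TS_span S" "star_subst star g"
  shows "evaluate fscale g f \<in> TS_span S"
  using assms TS_space_TS_span[of S] star_endomorphism_evaluate by (auto simp: TS_space_def)

lemma skew_mult_in_TS_span:
  assumes "star h = - h" "star k = - k"
  shows "h * k \<in> TS_span {var (Z 1) * var (Z 2)}"
proof -
  \<comment> \<open>All other generators are fixed, which keeps the substitution compatible with
    \<open>star\<close>.\<close>
  let ?g = "var(Z 1 := h, Z 2 := k)"
  have "star_subst star ?g"
    by (simp add: assms star_subst_def sym_part_def skew_part_def star_var)
  moreover have "var (Z 1) * var (Z 2) \<in> TS_span {var (Z 1) * var (Z 2)}"
    by (simp add: TS_span_def hull_inc)
  ultimately have "evaluate fscale ?g (var (Z 1) * var (Z 2)) \<in> TS_span {var (Z 1) * var (Z 2)}"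
    by (rule TS_span_evaluate[rotated])
  then show ?thesis
    by (simp add: free_alg.evaluate_mult free_alg.evaluate_var)
qed

lemma (in unital_algebra) evaluate_power: "evaluate scale g (f ^ n) = evaluate scale g f ^ n"
  by (induction n) (simp_all add: evaluate_one evaluate_mult)

lemma sym_power_in_TS_span:
  assumes "star h = h"
  shows "h ^ n \<in> TS_span {var (Y 1) ^ n}"
proof -
  let ?g = "var(Y 1 := h)"
  have "star_subst star ?g"
    by (simp add: assms star_subst_def sym_part_def skew_part_def star_var)
  moreover have "var (Y 1) ^ n \<in> TS_span {var (Y 1) ^ n}"
    by (simp add: TS_span_def hull_inc)
  ultimately have "evaluate fscale ?g (var (Y 1) ^ n) \<in> TS_span {var (Y 1) ^ n}"
    by (rule TS_span_evaluate[rotated])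
  then show ?thesis
    by (simp add: free_alg.evaluate_power free_alg.evaluate_var)
qed

context involution_algebra
begin

lemma center_subspace: "subspace center"
proof (rule subspaceI)
  show "0 \<in> center" by (simp add: center_def)
  show "x + y \<in> center" if "x \<in> center" "y \<in> center" for x y
    using that by (simp add: center_def distrib_left distrib_right)
  show "scale c x \<in> center" if "x \<in> center" for c x
    using that by (simp add: center_def scale_mult_left scale_mult_right)
qed

text \<open>Allows the inclusion of a \<open>TS_span\<close> in \<open>star_central\<close> to be
  checked on the generating polynomial alone.\<close>

lemma TS_space_star_central: "TS_space (star_central scale invol)"
  unfolding TS_space_def
proof (intro conjI allI impI)
  show "free_alg.subspace (star_central scale invol)"
    by (rule free_alg.subspaceI)
      (auto simp: star_central_iff evaluate_zero evaluate_add evaluate_fscale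
        subspace_0[OF center_subspace] subspace_add[OF center_subspace]
        subspace_scale[OF center_subspace])
next
  fix \<phi> :: "'f free_alg \<Rightarrow> 'f free_alg"
  assume \<phi>: "star_endomorphism \<phi>"
  have "evaluate scale g (\<phi> f) \<in> center"
    if f: "f \<in> star_central scale invol" and g: "star_subst invol g" for f g
    using f[unfolded star_central_iff, rule_format, OF evaluate_comp_star_endomorphism(1)[OF \<phi> g]]
    by (simp only: evaluate_comp_star_endomorphism(2)[OF \<phi> g, of f])
  then show "\<phi> ` star_central scale invol \<subseteq> star_central scale invol"
    by (auto simp: star_central_iff[of "\<phi> _"])
qed

lemma star_identities_subset_star_central:
  "star_identities scale invol \<subseteq> star_central scale invol"
  by (auto simp: star_identities_iff star_central_iff center_def)

end

section \<open>Entries of triangular matrices\<close>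

lift_definition ent11 :: "'f::field UT2 \<Rightarrow> 'f" is "\<lambda>A. A $ 1 $ 1" .
lift_definition ent12 :: "'f::field UT2 \<Rightarrow> 'f" is "\<lambda>A. A $ 1 $ 2" .
lift_definition ent22 :: "'f::field UT2 \<Rightarrow> 'f" is "\<lambda>A. A $ 2 $ 2" .

lift_definition UT2_mk :: "'f::field \<Rightarrow> 'f \<Rightarrow> 'f \<Rightarrow> 'f UT2"
  is "\<lambda>a c b. vector [vector [a, c], vector [0, b]]" by simp

lemma ent_mk [simp]: "ent11 (UT2_mk a c b) = a" "ent12 (UT2_mk a c b) = c" "ent22 (UT2_mk a c b) = b"
  by (transfer; simp)+

lemma UT2_eq_iff: "A = B \<longleftrightarrow> ent11 A = ent11 B \<and> ent12 A = ent12 B \<and> ent22 A = ent22 B"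
  by transfer (auto simp: vec_eq_iff forall_2)

lemma ent_zero [simp]: "ent11 0 = 0" "ent12 0 = 0" "ent22 0 = 0"
  by (transfer; simp)+

lemma ent_one [simp]: "ent11 1 = 1" "ent12 1 = 0" "ent22 1 = 1"
  by (transfer; simp add: mat_def)+

lemma ent_add [simp]:
  "ent11 (A + B) = ent11 A + ent11 B" "ent12 (A + B) = ent12 A + ent12 B"
  "ent22 (A + B) = ent22 A + ent22 B"
  by (transfer; simp)+

lemma ent_minus [simp]:
  "ent11 (A - B) = ent11 A - ent11 B" "ent12 (A - B) = ent12 A - ent12 B"
  "ent22 (A - B) = ent22 A - ent22 B"
  by (transfer; simp)+

lemma ent_uminus [simp]:
  "ent11 (- A) = - ent11 A" "ent12 (- A) = - ent12 A" "ent22 (- A) = - ent22 A"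
  by (transfer; simp)+

lemma ent_mult [simp]:
  "ent11 (A * B) = ent11 A * ent11 B"
  "ent12 (A * B) = ent11 A * ent12 B + ent12 A * ent22 B"
  "ent22 (A * B) = ent22 A * ent22 B"
  by (transfer; simp add: matrix_matrix_mult_def sum_2)+

lemma ent_scale [simp]:
  "ent11 (UT2_scale c A) = c * ent11 A" "ent12 (UT2_scale c A) = c * ent12 A"
  "ent22 (UT2_scale c A) = c * ent22 A"
  by (transfer; simp)+

lemma ent_star [simp]:
  "ent11 (UT2_star A) = ent22 A" "ent12 (UT2_star A) = ent12 A" "ent22 (UT2_star A) = ent11 A"
  by (transfer; simp)+

lemma ent_sum:
  "ent11 (sum h S) = (\<Sum>x\<in>S. ent11 (h x))" "ent12 (sum h S) = (\<Sum>x\<in>S. ent12 (h x))"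
  "ent22 (sum h S) = (\<Sum>x\<in>S. ent22 (h x))"
  by (induction S rule: infinite_finite_induct; simp)+

lemma ent11_prod_list: "ent11 (prod_list As) = prod_list (map ent11 As)"
  by (induction As) simp_all

lemma center_UT2_iff: "A \<in> center \<longleftrightarrow> ent11 A = ent22 A \<and> ent12 A = 0"
proof
  assume "A \<in> center"
  \<comment> \<open>Commuting with \<open>e12\<close> equates the diagonal entries; commuting with
    \<open>e11\<close> kills the upper right one.\<close>
  then have "A * UT2_mk 0 1 0 = UT2_mk 0 1 0 * A" "A * UT2_mk 1 0 0 = UT2_mk 1 0 0 * A"
    by (auto simp: center_def)
  then show "ent11 A = ent22 A \<and> ent12 A = 0"
    by (simp add: UT2_eq_iff)
qed (auto simp: center_def UT2_eq_iff)

lemma sym_part_UT2: "sym_part (UT2_star :: 'f::field UT2 \<Rightarrow> 'f UT2) = {A. ent11 A = ent22 A}"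
  by (auto simp: sym_part_def UT2_eq_iff)

lemma neg_eq_self_iff:
  fixes c :: "'f::field"
  assumes "(2 :: 'f) \<noteq> 0"
  shows "c = - c \<longleftrightarrow> c = 0"
proof -
  have "c = - c \<longleftrightarrow> 2 * c = 0"
    by (metis add.right_inverse eq_neg_iff_add_eq_0 mult_2)
  then show ?thesis using assms by simp
qed

lemma skew_part_UT2:
  assumes "(2 :: 'f) \<noteq> 0"
  shows "skew_part (UT2_star :: 'f::field UT2 \<Rightarrow> 'f UT2) = {A. ent22 A = - ent11 A \<and> ent12 A = 0}"
proof (intro set_eqI)
  fix A :: "'f UT2"
  have "ent11 A = - ent22 A \<longleftrightarrow> ent22 A = - ent11 A"
    by (metis minus_minus)
  then show "A \<in> skew_part UT2_star \<longleftrightarrow> A \<in> {A. ent22 A = - ent11 A \<and> ent12 A = 0}"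
    unfolding skew_part_def UT2_eq_iff mem_Collect_eq ent_star ent_uminus
      neg_eq_self_iff[OF assms] by blast
qed

text \<open>Here \<open>A = a + c e12\<close> with \<open>e12\<close> of square zero, so the
  binomial expansion stops at the linear term. For \<open>n = 0\<close> the truncated exponent is
  harmless because of the factor \<open>of_nat n\<close>.\<close>

lemma ent_power_eq_diag:
  assumes "ent11 A = ent22 A"
  shows "ent11 (A ^ n) = ent11 A ^ n" "ent22 (A ^ n) = ent11 A ^ n"
    "ent12 (A ^ n) = of_nat n * ent11 A ^ (n - 1) * ent12 A"
proof -
  show "ent11 (A ^ n) = ent11 A ^ n" "ent22 (A ^ n) = ent11 A ^ n" for n
    by (induction n) (simp_all add: assms)
  then show "ent12 (A ^ n) = of_nat n * ent11 A ^ (n - 1) * ent12 A"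
  proof (induction n)
    case (Suc n)
    then show ?case by (cases n) (simp_all add: algebra_simps assms[symmetric])
  qed simp
qed

lemma center_UT2_power_char:
  assumes "ent11 (A :: 'f::field UT2) = ent22 A"
  shows "A ^ CHAR('f) \<in> center"
  using assms by (simp add: center_UT2_iff ent_power_eq_diag)

section \<open>Words\<close>

definition zdeg :: "gen list \<Rightarrow> nat"
  where "zdeg xs = length (filter (\<lambda>x. \<exists>j. x = Z j) xs)"

lemma zdeg_simps [simp]:
  "zdeg [] = 0" "zdeg (Y i # xs) = zdeg xs" "zdeg (Z j # xs) = Suc (zdeg xs)"
  "zdeg (xs @ ys) = zdeg xs + zdeg ys"
  by (simp_all add: zdeg_def)

lemma zdeg_pos_obtain:
  assumes "zdeg xs > 0"
  obtains us j vs where "xs = us @ Z j # vs"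
proof -
  from assms have "\<exists>j. Z j \<in> set xs"
    by (auto simp: zdeg_def filter_empty_conv)
  then show ?thesis using that by (metis split_list)
qed

abbreviation monom_val :: "(gen \<Rightarrow> 'f::comm_monoid_mult) \<Rightarrow> gen list \<Rightarrow> 'f"
  where "monom_val u xs \<equiv> prod_list (map u xs)"

text \<open>Values of \<open>y\<close> have equal diagonal entries and values of \<open>z\<close>
  opposite ones, so each \<open>z\<close> contributes one sign.\<close>

lemma ent22_monom_val:
  assumes "(2 :: 'f::field) \<noteq> 0" "star_subst (UT2_star :: 'f UT2 \<Rightarrow> 'f UT2) g"
  shows "ent22 (prod_list (map g xs)) = (- 1) ^ zdeg xs * monom_val (ent11 \<circ> g) xs"
proof (induction xs)
  case (Cons x xs)
  then show ?case
    using assms(2) by (cases x) (simp_all add: star_subst_def sym_part_UT2 skew_part_UT2[OF assms(1)])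
qed simp

lemma repeat_mset_exists:
  assumes "\<And>x. n dvd count M x" "n > 0"
  obtains N where "M = repeat_mset n N"
proof
  let ?N = "\<Sum>x\<in>set_mset M. replicate_mset (count M x div n) x"
  show "M = repeat_mset n ?N"
    by (rule multiset_eqI)
      (use assms in \<open>auto simp: count_sum sum.delta not_in_iff if_distrib cong: if_cong\<close>)
qed

text \<open>The values commute, so only the multiset of letters counts, and its multiplicities can
  be divided by \<open>p\<close>. The inclusion of letter sets ensures that no \<open>z\<close>
  enters a word without \<open>z\<close>.\<close>

lemma monom_val_pth_power:
  assumes "\<And>x. p dvd count_list xs x" "p > 0"
  obtains ys where "set ys \<subseteq> set xs" "\<And>u :: gen \<Rightarrow> 'f::comm_monoid_mult. monom_val u ys ^ p = monom_val u xs"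
proof -
  from assms have "\<And>x. p dvd count (mset xs) x" by (simp add: count_mset)
  then obtain N where N: "mset xs = repeat_mset p N"
    using repeat_mset_exists assms(2) by blast
  obtain ys where ys: "mset ys = N" using ex_mset by blast
  have "monom_val u ys ^ p = monom_val u xs" for u :: "gen \<Rightarrow> 'f"
  proof -
    have "monom_val u xs = prod_mset (image_mset u (mset xs))"
      by (metis mset_map prod_mset_prod_list)
    also have "\<dots> = prod_mset (image_mset u (mset ys)) ^ p"
      unfolding N ys by (induction p) simp_all
    also have "prod_mset (image_mset u (mset ys)) = monom_val u ys"
      by (metis mset_map prod_mset_prod_list)
    finally show ?thesis by simp
  qed
  moreover have "set ys \<subseteq> set xs"
  proof
    fix x assume "x \<in> set ys"
    then have "count (mset xs) x > 0"
      unfolding N using ys assms(2) by (simp add: repeat_mset.rep_eq flip: ys)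
    then show "x \<in> set xs" by simp
  qed
  ultimately show ?thesis using that by blast
qed

section \<open>Commutative polynomials vanishing as functions\<close>

text \<open>Separates one variable: the second factor is the cofactor of the power of
  \<open>x\<close> and does not involve \<open>t\<close>.\<close>

lemma monom_val_update:
  "monom_val (u(x := t)) xs = t ^ count_list xs x * monom_val (u(x := 1)) (xs :: gen list)"
  for t :: "'f::comm_ring_1"
  by (induction xs) (simp_all add: mult_ac)

text \<open>Fixing all values but that of \<open>x\<close> gives a univariate polynomial with
  infinitely many roots. Its coefficients vanish, so each component homogeneous in \<open>x\<close>
  vanishes separately and may be reweighted by any function \<open>\<phi>\<close> of its
  degree.\<close>

lemma sum_monom_val_weight:
  fixes d :: "'w \<Rightarrow> 'f::field"
  assumes "infinite (UNIV :: 'f set)" "finite W"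
    and zero: "\<And>u. (\<Sum>w\<in>W. d w * monom_val u (l w)) = 0"
  shows "(\<Sum>w\<in>W. \<phi> (count_list (l w) x) * d w * monom_val u (l w)) = 0"
proof -
  define e where "e w = d w * monom_val (u(x := 1)) (l w)" for w
  define q where "q = (\<Sum>w\<in>W. monom (e w) (count_list (l w) x))"
  have "poly q t = 0" for t
  proof -
    have "poly q t = (\<Sum>w\<in>W. d w * monom_val (u(x := t)) (l w))"
      unfolding q_def e_def monom_val_update[of u x t]
      by (simp add: poly_sum poly_monom mult_ac)
    then show ?thesis using zero by simp
  qed
  then have "q = 0"
    using poly_roots_finite[of q] assms(1) by auto
  then have coeff: "(\<Sum>w\<in>W. if count_list (l w) x = n then e w else 0) = 0" for n
    unfolding q_def by (simp add: poly_eq_iff coeff_sum)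
  define N where "N = (\<lambda>w. count_list (l w) x) ` W"
  \<comment> \<open>Updating \<open>u\<close> at \<open>x\<close> to its own value
    \<open>u x\<close> changes nothing, but splits the power of \<open>u x\<close> off each
    monomial.\<close>
  have "(\<Sum>w\<in>W. \<phi> (count_list (l w) x) * d w * monom_val u (l w)) =
      (\<Sum>w\<in>W. \<phi> (count_list (l w) x) * u x ^ count_list (l w) x * e w)"
    using monom_val_update[of u x "u x"] by (simp add: e_def mult_ac)
  also have "\<dots> = (\<Sum>w\<in>W. \<Sum>n\<in>N. \<phi> n * u x ^ n * (if count_list (l w) x = n then e w else 0))"
    using assms(2) by (intro sum.cong) (auto simp: N_def if_distrib cong: if_cong)
  also have "\<dots> = (\<Sum>n\<in>N. \<phi> n * u x ^ n * (\<Sum>w\<in>W. if count_list (l w) x = n then e w else 0))"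
    unfolding sum_distrib_left by (rule sum.swap)
  finally show ?thesis by (simp add: coeff)
qed

text \<open>The hypothesis says that the Euler operators \<open>x \<partial>/\<partial>x\<close>
  with \<open>x\<close> in \<open>S\<close> annihilate the polynomial. Each forces the part whose
  degree in \<open>x\<close> is nonzero in the field to vanish; inclusion-exclusion joins these
  parts over \<open>S\<close>.\<close>

lemma sum_monom_val_nonzero_degree:
  fixes c :: "'w \<Rightarrow> 'f::field"
  assumes inf: "infinite (UNIV :: 'f set)" and "finite W" "finite S"
    and zero: "\<And>x u. x \<in> S \<Longrightarrow>
      (\<Sum>w\<in>W. of_nat (count_list (l w) x) * c w * monom_val u (l w)) = 0"
  shows "(\<Sum>w\<in>W. of_bool (\<exists>x\<in>S. of_nat (count_list (l w) x) \<noteq> (0::'f)) * c w * monom_val u (l w)) = 0"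
  using \<open>finite S\<close> zero
proof (induction S arbitrary: u rule: finite_induct)
  case (insert x S)
  define b where "b w = (of_bool (\<exists>x\<in>S. of_nat (count_list (l w) x) \<noteq> (0::'f)) :: 'f)" for w
  define a where "a w = (of_bool (of_nat (count_list (l w) x) \<noteq> (0::'f)) :: 'f)" for w
  have 1: "(\<Sum>w\<in>W. b w * c w * monom_val u (l w)) = 0" for u
    unfolding b_def using insert by blast
  \<comment> \<open>Weighting by the inverse degree cancels the factor from the Euler operator; as
    \<open>inverse 0 = 0\<close>, what remains is the indicator \<open>a\<close>.\<close>
  have "(\<Sum>w\<in>W. inverse (of_nat (count_list (l w) x)) *
      (of_nat (count_list (l w) x) * c w) * monom_val u (l w)) = 0"
    using insert.prems
    by (intro sum_monom_val_weight[OF inf \<open>finite W\<close>, where \<phi> = "\<lambda>n. inverse (of_nat n)"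
          and d = "\<lambda>w. of_nat (count_list (l w) x) * c w"]) simp
  then have 2: "(\<Sum>w\<in>W. a w * c w * monom_val u (l w)) = 0"
    by (rule trans[rotated]) (auto intro!: sum.cong simp: a_def)
  \<comment> \<open>Restricting the identity for \<open>S\<close> to nonzero degree in
    \<open>x\<close> yields the intersection term.\<close>
  have "(\<Sum>w\<in>W. of_bool (of_nat (count_list (l w) x) \<noteq> (0::'f)) *
      (b w * c w) * monom_val u (l w)) = 0"
    by (rule sum_monom_val_weight[OF inf \<open>finite W\<close> 1, where \<phi> = "\<lambda>n. of_bool (of_nat n \<noteq> 0)"])
  then have 3: "(\<Sum>w\<in>W. a w * b w * c w * monom_val u (l w)) = 0"
    by (simp add: a_def mult.assoc)
  have ab: "of_bool (\<exists>y\<in>insert x S. of_nat (count_list (l w) y) \<noteq> (0::'f)) = a w + b w - a w * b w" for w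
    by (auto simp: a_def b_def)
  show ?case
    unfolding ab using 1[of u] 2 3 by (simp add: ring_distribs sum.distrib sum_subtractf)
qed simp

section \<open>Central polynomials of the triangular matrices\<close>

lemma evaluate_word:
  "evaluate UT2_scale g (Poly_Mapping.single (Word xs) 1) = prod_list (map g xs)"
  by (simp add: UT2.evaluate_single)

text \<open>Elements of this span take central values, so prescribing the upper left entry
  prescribes the whole value. Moving \<open>Z j\<close> to the front is harmless because diagonal
  entries commute.\<close>

lemma even_word_central:
  assumes two: "(2 :: 'f::field) \<noteq> 0" and "even (zdeg xs)" "zdeg xs > 0"
  obtains f :: "'f::field free_alg" where "f \<in> TS_span {var (Z 1) * var (Z 2)}"
    "\<And>g. star_subst UT2_star g \<Longrightarrow> ent11 (evaluate UT2_scale g f) = monom_val (ent11 \<circ> g) xs"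
proof -
  obtain us j vs where xs: "xs = us @ Z j # vs"
    using assms(3) by (rule zdeg_pos_obtain)
  define w :: "'f free_alg" where "w = Poly_Mapping.single (Word (us @ vs)) 1"
  define h where "h = fscale (1 / 2) (w - star w)"
  have "star h = - h"
    by (simp add: h_def star_fscale free_alg.inv.diff star_star
        flip: free_alg.scale_minus_right)
  then have "var (Z j) * h \<in> TS_span {var (Z 1) * var (Z 2)}"
    by (intro skew_mult_in_TS_span) (simp_all add: star_var)
  moreover have "ent11 (evaluate UT2_scale g (var (Z j) * h)) = monom_val (ent11 \<circ> g) xs"
    if g: "star_subst UT2_star g" for g
  proof -
    interpret e: Vector_Spaces.linear fscale UT2_scale "evaluate UT2_scale g"
      using UT2.evaluate_hom unfolding unital_alg_hom_def by blast
    \<comment> \<open>Without \<open>Z j\<close> the number of \<open>z\<close> is odd, so the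
      diagonal entries of the value of \<open>w\<close> are opposite and \<open>h\<close> keeps the
      upper left one.\<close>
    have "odd (zdeg (us @ vs))" using assms(2) by (simp add: xs)
    then have "ent22 (evaluate UT2_scale g w) = - ent11 (evaluate UT2_scale g w)"
      by (simp only: w_def evaluate_word ent22_monom_val[OF two g] ent11_prod_list) simp
    then have "ent11 (evaluate UT2_scale g h) = ent11 (evaluate UT2_scale g w)"
      using two by (simp add: h_def UT2.evaluate_fscale e.diff UT2.evaluate_star[OF g] field_simps)
    then show ?thesis
      by (simp add: xs UT2.evaluate_mult UT2.evaluate_var w_def evaluate_word ent11_prod_list mult_ac)
  qed
  ultimately show ?thesis using that by blast
qed

lemma pth_power_word_central:
  assumes two: "(2 :: 'f::field) \<noteq> 0" and "p > 0" "zdeg xs = 0" "\<And>x. p dvd count_list xs x"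
  obtains f :: "'f::field free_alg" where "f \<in> TS_span {var (Y 1) ^ p}"
    "\<And>g. star_subst UT2_star g \<Longrightarrow> ent11 (evaluate UT2_scale g f) = monom_val (ent11 \<circ> g) xs"
proof -
  obtain ys where sub: "set ys \<subseteq> set xs"
    and ys: "\<And>u :: gen \<Rightarrow> 'f. monom_val u ys ^ p = monom_val u xs"
    using monom_val_pth_power assms(4,2) by blast
  define w :: "'f free_alg" where "w = Poly_Mapping.single (Word ys) 1"
  define h where "h = fscale (1 / 2) (w + star w)"
  have "star h = h"
    by (simp add: h_def star_fscale star_add star_star add.commute)
  then have "h ^ p \<in> TS_span {var (Y 1) ^ p}"
    by (rule sym_power_in_TS_span)
  moreover have "ent11 (evaluate UT2_scale g (h ^ p)) = monom_val (ent11 \<circ> g) xs"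
    if g: "star_subst UT2_star g" for g
  proof -
    \<comment> \<open>As \<open>w\<close> contains no \<open>z\<close>, its diagonal entries agree;
      symmetrizing preserves them and the \<open>p\<close>-th power restores the monomial of
      \<open>xs\<close>.\<close>
    have "zdeg ys = 0" using assms(3) sub by (auto simp: zdeg_def filter_empty_conv)
    then have "ent22 (evaluate UT2_scale g w) = ent11 (evaluate UT2_scale g w)"
      by (simp only: w_def evaluate_word ent22_monom_val[OF two g] ent11_prod_list) simp
    then have "ent11 (evaluate UT2_scale g h) = ent11 (evaluate UT2_scale g w)"
        "ent22 (evaluate UT2_scale g h) = ent11 (evaluate UT2_scale g w)"
      using two by (simp_all add: h_def UT2.evaluate_fscale UT2.evaluate_add UT2.evaluate_star[OF g])
    then show ?thesis
      by (simp add: UT2.evaluate_power ent_power_eq_diag w_def evaluate_word ent11_prod_list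
          flip: ys[of "ent11 \<circ> g"])
  qed
  ultimately show ?thesis using that by blast
qed

section \<open>Vanishing conditions on central polynomials\<close>

lemma ent_evaluate:
  "ent11 (evaluate UT2_scale g f) =
    (\<Sum>w\<in>Poly_Mapping.keys f. Poly_Mapping.lookup f w * ent11 (prod_list (map g (letters w))))"
  "ent12 (evaluate UT2_scale g f) =
    (\<Sum>w\<in>Poly_Mapping.keys f. Poly_Mapping.lookup f w * ent12 (prod_list (map g (letters w))))"
  "ent22 (evaluate UT2_scale g f) =
    (\<Sum>w\<in>Poly_Mapping.keys f. Poly_Mapping.lookup f w * ent22 (prod_list (map g (letters w))))"
  by (simp_all add: evaluate_def ent_sum)

text \<open>Substituting \<open>a\<^sub>i + a\<^sub>i e\<^sub>1\<^sub>2\<close> for one \<open>y\<^sub>i\<close> makes the upper right entry the Euler operator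
  \<open>a\<^sub>i \<partial>/\<partial>a\<^sub>i\<close> of the commutative polynomial obtained by setting all \<open>z\<close> to 0.\<close>

lemma star_central_euler:
  assumes "f \<in> star_central UT2_scale (UT2_star :: 'f::field UT2 \<Rightarrow> 'f UT2)"
  shows "(\<Sum>w\<in>{w \<in> Poly_Mapping.keys f. zdeg (letters w) = 0}.
    of_nat (count_list (letters w) (Y i)) * Poly_Mapping.lookup f w * monom_val u (letters w)) = 0"
proof -
  define g where "g = case_gen (\<lambda>k. UT2_mk (u (Y k)) (if k = i then u (Y k) else 0) (u (Y k))) (\<lambda>_. 0)"
  have g: "star_subst UT2_star g"
    by (simp add: star_subst_def sym_part_UT2 skew_part_def g_def UT2_eq_iff)
  have pos: "prod_list (map g xs) = 0" if "zdeg xs > 0" for xs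
    using that by (rule zdeg_pos_obtain) (simp add: g_def)
  have null: "ent11 (prod_list (map g xs)) = monom_val u xs \<and> ent22 (prod_list (map g xs)) = monom_val u xs \<and>
      ent12 (prod_list (map g xs)) = of_nat (count_list xs (Y i)) * monom_val u xs" if "zdeg xs = 0" for xs
    using that
  proof (induction xs)
    case (Cons x xs)
    then show ?case by (cases x) (auto simp: g_def algebra_simps)
  qed simp
  have "0 = ent12 (evaluate UT2_scale g f)"
    using assms g by (simp add: star_central_iff center_UT2_iff)
  also have "\<dots> = (\<Sum>w\<in>{w \<in> Poly_Mapping.keys f. zdeg (letters w) = 0}.
    of_nat (count_list (letters w) (Y i)) * Poly_Mapping.lookup f w * monom_val u (letters w))"
    unfolding ent_evaluate
    by (rule sum.mono_neutral_cong_right) (auto simp: pos null)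
  finally show ?thesis by simp
qed

text \<open>In the difference of the two diagonal entries, which is zero, words with an even number
  of \<open>z\<close> cancel and the others count twice.\<close>

lemma star_central_odd:
  assumes two: "(2 :: 'f::field) \<noteq> 0"
    and "f \<in> star_central UT2_scale (UT2_star :: 'f UT2 \<Rightarrow> 'f UT2)" "star_subst UT2_star g"
  shows "(\<Sum>w\<in>{w \<in> Poly_Mapping.keys f. odd (zdeg (letters w))}.
    Poly_Mapping.lookup f w * monom_val (ent11 \<circ> g) (letters w)) = 0" (is "?s = 0")
proof -
  have "0 = ent11 (evaluate UT2_scale g f) - ent22 (evaluate UT2_scale g f)"
    using assms by (simp add: star_central_iff center_UT2_iff)
  also have "\<dots> = (\<Sum>w\<in>{w \<in> Poly_Mapping.keys f. odd (zdeg (letters w))}.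
      2 * (Poly_Mapping.lookup f w * monom_val (ent11 \<circ> g) (letters w)))"
    unfolding ent_evaluate sum_subtractf[symmetric] ent22_monom_val[OF two assms(3)] ent11_prod_list
    by (rule sum.mono_neutral_cong_right) (auto simp: algebra_simps)
  also have "\<dots> = 2 * ?s" by (simp add: sum_distrib_left)
  finally show ?thesis using two by simp
qed

text \<open>Every letter of a word without \<open>z\<close> is some \<open>Y i\<close>, so the Euler
  operators cover all its variables. A degree is nonzero in the field exactly when
  \<open>CHAR('f)\<close> does not divide it.\<close>

lemma star_central_degree_not_dvd:
  assumes inf: "infinite (UNIV :: 'f::field set)"
    and f: "f \<in> star_central UT2_scale (UT2_star :: 'f UT2 \<Rightarrow> 'f UT2)"
  shows "(\<Sum>w\<in>{w \<in> Poly_Mapping.keys f. zdeg (letters w) = 0 \<and>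
      (\<exists>x. \<not> CHAR('f) dvd count_list (letters w) x)}.
    Poly_Mapping.lookup f w * monom_val u (letters w)) = 0"
proof -
  define W where "W = {w \<in> Poly_Mapping.keys f. zdeg (letters w) = 0}"
  define S where "S = (\<Union>w\<in>W. set (letters w))"
  have fin: "finite W" "finite S" by (simp_all add: W_def S_def)
  have Y: "\<exists>i. x = Y i" if "x \<in> S" for x
    using that by (cases x) (simp_all add: S_def W_def zdeg_def filter_empty_conv, blast)
  have "(\<Sum>w\<in>W. of_nat (count_list (letters w) x) * Poly_Mapping.lookup f w * monom_val v (letters w)) = 0"
    if x: "x \<in> S" for x v
  proof -
    obtain i where "x = Y i" using Y[OF x] by blast
    then show ?thesis using star_central_euler[OF f, of i v] by (simp add: W_def)
  qed
  from sum_monom_val_nonzero_degree[OF inf fin this]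
  have "0 = (\<Sum>w\<in>W. of_bool (\<exists>x\<in>S. of_nat (count_list (letters w) x) \<noteq> (0::'f)) *
      Poly_Mapping.lookup f w * monom_val u (letters w))"
    by (rule sym)
  also have "\<dots> = (\<Sum>w\<in>{w \<in> Poly_Mapping.keys f. zdeg (letters w) = 0 \<and>
      (\<exists>x. \<not> CHAR('f) dvd count_list (letters w) x)}.
    Poly_Mapping.lookup f w * monom_val u (letters w))"
  proof (rule sum.mono_neutral_cong_right[OF fin(1)])
    \<comment> \<open>A letter outside \<open>S\<close> has degree 0 in \<open>w\<close>, and the
      characteristic divides 0.\<close>
    have bad: "(\<exists>x\<in>S. of_nat (count_list (letters w) x) \<noteq> (0::'f)) \<longleftrightarrow>
        (\<exists>x. \<not> CHAR('f) dvd count_list (letters w) x)" if "w \<in> W" for w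
    proof -
      have "x \<in> S" if "\<not> CHAR('f) dvd count_list (letters w) x" for x
      proof -
        have "x \<in> set (letters w)"
          using that by (cases "x \<in> set (letters w)") simp_all
        then show ?thesis using \<open>w \<in> W\<close> unfolding S_def by blast
      qed
      then show ?thesis unfolding of_nat_eq_0_iff_char_dvd by blast
    qed
    show "\<forall>w\<in>W - {w \<in> Poly_Mapping.keys f. zdeg (letters w) = 0 \<and>
        (\<exists>x. \<not> CHAR('f) dvd count_list (letters w) x)}.
      of_bool (\<exists>x\<in>S. of_nat (count_list (letters w) x) \<noteq> (0::'f)) *
        Poly_Mapping.lookup f w * monom_val u (letters w) = 0"
      using bad by (auto simp: W_def)
    show "of_bool (\<exists>x\<in>S. of_nat (count_list (letters w) x) \<noteq> (0::'f)) *
        Poly_Mapping.lookup f w * monom_val u (letters w) =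
      Poly_Mapping.lookup f w * monom_val u (letters w)"
      if "w \<in> {w \<in> Poly_Mapping.keys f. zdeg (letters w) = 0 \<and>
        (\<exists>x. \<not> CHAR('f) dvd count_list (letters w) x)}" for w
      using that bad[of w] by (simp add: W_def)
  qed (auto simp: W_def)
  finally show ?thesis by simp
qed

theorem theorem4p9:
  fixes p :: nat
  assumes "infinite (UNIV :: 'f::field set)"
    and "CHAR('f) = p"
    and "p > 2"
  shows "star_central UT2_scale (UT2_star :: 'f UT2 \<Rightarrow> 'f UT2) =
    star_identities UT2_scale (UT2_star :: 'f UT2 \<Rightarrow> 'f UT2)
      + TS_span {var (Z 1) * var (Z 2)} + TS_span {var (Y 1) ^ p}"
    (is "?C = ?I + ?V + ?W")
proof
  have two: "(2 :: 'f) \<noteq> 0"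
    using of_nat_eq_0_iff_char_dvd[of 2, where 'a = 'f] assms(2,3) by (auto dest: dvd_imp_le)
  \<comment> \<open>By minimality of the hull only \<open>z1 z2\<close> needs checking: a product of
    two multiples of \<open>e11 - e22\<close> is scalar.\<close>
  have V: "?V \<subseteq> ?C"
    unfolding TS_span_def
    by (rule hull_minimal)
      (auto simp: UT2.TS_space_star_central star_central_iff UT2.evaluate_mult UT2.evaluate_var
        center_UT2_iff star_subst_def skew_part_UT2[OF two])
  have W: "?W \<subseteq> ?C"
    unfolding TS_span_def
    by (rule hull_minimal)
      (auto simp: UT2.TS_space_star_central star_central_iff UT2.evaluate_power UT2.evaluate_var
        star_subst_def sym_part_UT2 center_UT2_power_char simp flip: assms(2))
  have C: "free_alg.subspace ?C"
    using UT2.TS_space_star_central by (auto simp: TS_space_def)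
  show "?I + ?V + ?W \<subseteq> ?C"
  proof
    fix f assume "f \<in> ?I + ?V + ?W"
    then obtain a b c where "a \<in> ?I" "b \<in> ?V" "c \<in> ?W" "f = a + b + c"
      by (auto elim!: set_plus_elim)
    then show "f \<in> ?C"
      using V W UT2.star_identities_subset_star_central
      by (auto intro!: free_alg.subspace_add[OF C])
  qed
  show "?C \<subseteq> ?I + ?V + ?W"
  proof
    fix f assume f: "f \<in> ?C"
    let ?c = "Poly_Mapping.lookup f"
    define K where "K = Poly_Mapping.keys f"
    \<comment> \<open>The support splits into four parts: \<open>E\<close> and \<open>P\<close> are
      matched by elements of the two spans, while \<open>B\<close> and \<open>D\<close> contribute
      zero to the upper left entry.\<close>
    define E where "E = {w \<in> K. even (zdeg (letters w)) \<and> zdeg (letters w) > 0}"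
    define P where "P = {w \<in> K. zdeg (letters w) = 0 \<and> (\<forall>x. p dvd count_list (letters w) x)}"
    define B where "B = {w \<in> K. zdeg (letters w) = 0 \<and> (\<exists>x. \<not> p dvd count_list (letters w) x)}"
    define D where "D = {w \<in> K. odd (zdeg (letters w))}"
    have "\<exists>h. h \<in> ?V \<and> (\<forall>g. star_subst UT2_star g \<longrightarrow>
        ent11 (evaluate UT2_scale g h) = monom_val (ent11 \<circ> g) (letters w))" if "w \<in> E" for w
      using even_word_central[OF two, of "letters w"] that unfolding E_def by blast
    then obtain h where h: "\<And>w. w \<in> E \<Longrightarrow> h w \<in> ?V"
        "\<And>w g. w \<in> E \<Longrightarrow> star_subst UT2_star g \<Longrightarrow>
          ent11 (evaluate UT2_scale g (h w)) = monom_val (ent11 \<circ> g) (letters w)"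
      by metis
    have "\<exists>k. k \<in> ?W \<and> (\<forall>g. star_subst UT2_star g \<longrightarrow>
        ent11 (evaluate UT2_scale g k) = monom_val (ent11 \<circ> g) (letters w))" if "w \<in> P" for w
    proof -
      have "p > 0" "zdeg (letters w) = 0" "\<And>x. p dvd count_list (letters w) x"
        using that assms(3) by (auto simp: P_def)
      then show ?thesis
        using pth_power_word_central[OF two, of p "letters w"] by metis
    qed
    then obtain k where k: "\<And>w. w \<in> P \<Longrightarrow> k w \<in> ?W"
        "\<And>w g. w \<in> P \<Longrightarrow> star_subst UT2_star g \<Longrightarrow>
          ent11 (evaluate UT2_scale g (k w)) = monom_val (ent11 \<circ> g) (letters w)"
      by metis
    define v where "v = (\<Sum>w\<in>E. fscale (?c w) (h w))"
    define q where "q = (\<Sum>w\<in>P. fscale (?c w) (k w))"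
    have v: "v \<in> ?V" and q: "q \<in> ?W"
      unfolding v_def q_def
      by (intro free_alg.subspace_sum free_alg.subspace_scale subspace_TS_span h k; assumption)+
    \<comment> \<open>The difference is still central, so it is an identity once its upper left
      entry always vanishes.\<close>
    have "f - v - q \<in> ?I"
      unfolding star_identities_iff
    proof (intro allI impI)
      fix g :: "gen \<Rightarrow> 'f UT2" assume g: "star_subst UT2_star g"
      interpret e: Vector_Spaces.linear fscale UT2_scale "evaluate UT2_scale g"
        using UT2.evaluate_hom unfolding unital_alg_hom_def by blast
      have "f - v - q \<in> ?C"
        using f v q V W by (intro free_alg.subspace_diff[OF C]) auto
      then have "evaluate UT2_scale g (f - v - q) \<in> center"
        using g by (simp add: star_central_iff)
      moreover have "ent11 (evaluate UT2_scale g (f - v - q)) = 0"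
      proof -
        define m where "m w = ?c w * monom_val (ent11 \<circ> g) (letters w)" for w
        have K: "K = E \<union> P \<union> B \<union> D"
          by (auto simp: E_def P_def B_def D_def)
        have fin: "finite E" "finite P" "finite B" "finite D"
          by (simp_all add: E_def P_def B_def D_def K_def)
        have dis: "E \<inter> P = {}" "(E \<union> P) \<inter> B = {}" "(E \<union> P \<union> B) \<inter> D = {}"
          by (auto simp: E_def P_def B_def D_def)
        have "sum m K = sum m E + sum m P + sum m B + sum m D"
          unfolding K using fin dis by (simp add: sum.union_disjoint)
        moreover have "sum m B = 0"
          using star_central_degree_not_dvd[OF assms(1) f, of "ent11 \<circ> g"] assms(2)
          by (simp add: m_def B_def K_def)
        moreover have "sum m D = 0"
          using star_central_odd[OF two f g] by (simp add: m_def D_def K_def)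
        moreover have "ent11 (evaluate UT2_scale g f) = sum m K"
          by (simp add: ent_evaluate m_def K_def ent11_prod_list)
        moreover have "ent11 (evaluate UT2_scale g v) = sum m E"
          by (simp add: v_def e.sum ent_sum UT2.evaluate_fscale m_def h g)
        moreover have "ent11 (evaluate UT2_scale g q) = sum m P"
          by (simp add: q_def e.sum ent_sum UT2.evaluate_fscale m_def k g)
        ultimately show ?thesis by (simp add: e.diff)
      qed
      ultimately show "evaluate UT2_scale g (f - v - q) = 0"
        by (simp add: center_UT2_iff UT2_eq_iff)
    qed
    then have "(f - v - q) + v + q \<in> ?I + ?V + ?W"
      using v q by (intro set_plus_intro)
    then show "f \<in> ?I + ?V + ?W" by simp
  qed
qed

end
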